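(* Let $A$ be a skew left brace. Then the map $$r_A\colon A\times A\to A\times A,\qquad r_A(a,b)=\left(\lambda_a(b),\ \lambda^{-1}_{\lambda_a(b)}\left((a\circ b)^{-1}a(a\circ b)\right)\right),$$ is a non-degenerate solution of the Yang--Baxter equation. Furthermore, $r_A$ is involutive if and only if $ab=ba$ for all $a,b\in A$.
   Context: A skew left brace is a set $A$ with two group structures, $(A,\cdot)$ (written $(a,b)\mapsto ab$, with inverse $a^{-1}$, not necessarily abelian) and $(A,\circ)$, such that $a\circ(bc)=(a\circ b)a^{-1}(a\circ c)$ for all $a,b,c\in A$. For $a\in A$, $\lambda_a\colon A\to A$ is the bijective map $\lambda_a(b)=a^{-1}(a\circ b)$; $\lambda_a^{-1}$ denotes its inverse map. A (set-theoretical) solution of the Yang--Baxter equation is a pair $(X,r)$ with $X$ a set and $r\colon X\times X\to X\times X$, $r(x,y)=(\sigma_x(y),\tau_y(x))$, a bijective map such that $(r\times\mathrm{id})(\mathrm{id}\times r)(r\times\mathrm{id})=(\mathrm{id}\times r)(r\times\mathrm{id})(\mathrm{id}\times r)$ on $X\times X\times X$. It is non-degenerate if $\sigma_x$ and $\tau_x$ are bijective maps $X\to X$ for every $x\in X$, and involutive if $r^2=\mathrm{id}_{X\times X}$. *)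

theory Defs
  imports "HOL-Algebra.Group"
begin

text \<open>
  A skew left brace is a pair of groups \<open>A\<close> (product \<open>ab\<close>) and \<open>B\<close> (product \<open>a \<circ> b\<close>) on one
  carrier. That the two unit elements agree is a consequence, not an assumption.
\<close>

locale skew_left_brace =
  dot: group A + circ: group B
  for A :: "('a, 'm) monoid_scheme" and B :: "('a, 'n) monoid_scheme" +
  assumes carrier_eq: "carrier B = carrier A"
    and brace_compat: "\<lbrakk>a \<in> carrier A; b \<in> carrier A; c \<in> carrier A\<rbrakk> \<Longrightarrow>
      a \<otimes>\<^bsub>B\<^esub> (b \<otimes>\<^bsub>A\<^esub> c) =
        (a \<otimes>\<^bsub>B\<^esub> b) \<otimes>\<^bsub>A\<^esub> (inv\<^bsub>A\<^esub> a) \<otimes>\<^bsub>A\<^esub> (a \<otimes>\<^bsub>B\<^esub> c)"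

definition brace_lambda ::
    "('a, 'm) monoid_scheme \<Rightarrow> ('a, 'n) monoid_scheme \<Rightarrow> 'a \<Rightarrow> 'a \<Rightarrow> 'a" where
  "brace_lambda A B a b = (inv\<^bsub>A\<^esub> a) \<otimes>\<^bsub>A\<^esub> (a \<otimes>\<^bsub>B\<^esub> b)"

definition brace_r ::
    "('a, 'm) monoid_scheme \<Rightarrow> ('a, 'n) monoid_scheme \<Rightarrow> 'a \<times> 'a \<Rightarrow> 'a \<times> 'a" where
  "brace_r A B = (\<lambda>(a, b).
     (brace_lambda A B a b,
      inv_into (carrier A) (brace_lambda A B (brace_lambda A B a b))
        (inv\<^bsub>A\<^esub> (a \<otimes>\<^bsub>B\<^esub> b) \<otimes>\<^bsub>A\<^esub> a \<otimes>\<^bsub>A\<^esub> (a \<otimes>\<^bsub>B\<^esub> b))))"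

text \<open>
  A map \<open>X \<times> X \<rightarrow> X \<times> X\<close> is a HOL function of which only the values on \<open>X \<times> X\<close> matter.
  Triples nest to the right, so \<open>id \<times> r\<close> is \<^term>\<open>map_prod id r\<close>, whereas \<open>r \<times> id\<close> needs
  reassociation.
\<close>

definition r_times_id :: "('a \<times> 'a \<Rightarrow> 'a \<times> 'a) \<Rightarrow> 'a \<times> 'a \<times> 'a \<Rightarrow> 'a \<times> 'a \<times> 'a" where
  "r_times_id r = (\<lambda>(x, y, z). (fst (r (x, y)), snd (r (x, y)), z))"

definition id_times_r :: "('a \<times> 'a \<Rightarrow> 'a \<times> 'a) \<Rightarrow> 'a \<times> 'a \<times> 'a \<Rightarrow> 'a \<times> 'a \<times> 'a" where
  "id_times_r r = map_prod id r"

definition ybe_solution :: "'a set \<Rightarrow> ('a \<times> 'a \<Rightarrow> 'a \<times> 'a) \<Rightarrow> bool" where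
  "ybe_solution X r \<longleftrightarrow>
     bij_betw r (X \<times> X) (X \<times> X) \<and>
     (\<forall>t \<in> X \<times> X \<times> X.
        (r_times_id r \<circ> id_times_r r \<circ> r_times_id r) t =
        (id_times_r r \<circ> r_times_id r \<circ> id_times_r r) t)"

text \<open>\<open>r (x, y) = (\<sigma>\<^sub>x y, \<tau>\<^sub>y x)\<close>: the subscript of \<open>\<tau>\<close> is the second argument of \<open>r\<close>.\<close>

definition ybe_sigma :: "('a \<times> 'a \<Rightarrow> 'a \<times> 'a) \<Rightarrow> 'a \<Rightarrow> 'a \<Rightarrow> 'a" where
  "ybe_sigma r x y = fst (r (x, y))"

definition ybe_tau :: "('a \<times> 'a \<Rightarrow> 'a \<times> 'a) \<Rightarrow> 'a \<Rightarrow> 'a \<Rightarrow> 'a" where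
  "ybe_tau r y x = snd (r (x, y))"

definition ybe_nondegenerate :: "'a set \<Rightarrow> ('a \<times> 'a \<Rightarrow> 'a \<times> 'a) \<Rightarrow> bool" where
  "ybe_nondegenerate X r \<longleftrightarrow>
     (\<forall>x \<in> X. bij_betw (ybe_sigma r x) X X \<and> bij_betw (ybe_tau r x) X X)"

definition ybe_involutive :: "'a set \<Rightarrow> ('a \<times> 'a \<Rightarrow> 'a \<times> 'a) \<Rightarrow> bool" where
  "ybe_involutive X r \<longleftrightarrow> (\<forall>p \<in> X \<times> X. (r \<circ> r) p = p)"

end

theory Submission
  imports Defs
begin

text \<open>
  Write \<open>\<sigma> = \<lambda>\<^sub>a b\<close> and \<open>r (a, b) = (\<sigma>, \<tau>)\<close>. By definition \<open>\<sigma> = a\<inverse>(a \<circ> b)\<close>, and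
  \<open>\<lambda>\<^sub>\<sigma> \<tau> = (a \<circ> b)\<inverse> a (a \<circ> b) = \<sigma>\<inverse> (a \<circ> b)\<close> says exactly that \<open>\<sigma> \<circ> \<tau> = a \<circ> b\<close>. So \<open>r\<close>
  preserves the circle product, and \<open>\<tau>\<close> is the circle inverse of \<open>\<sigma>\<close> times \<open>a \<circ> b\<close>.

  Two of the claims follow by changing coordinates from \<open>(a, b)\<close> to \<open>(a, c)\<close> with \<open>c = a \<circ> b\<close>:
  there \<open>r\<close> becomes \<open>(a, c) \<mapsto> (a\<inverse> c, c)\<close>. This map is plainly bijective, and its square is
  \<open>(a, c) \<mapsto> (c\<inverse> a c, c)\<close>, which is the identity iff the dot product is commutative.

  The braid relation and non-degeneracy come from \<open>\<lambda>\<close> being a left action and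
  \<open>\<tau>\<close> a right action of the circle group (\<open>lambda_circ\<close> and \<open>rho_circ\<close>).
  Both sides of the braid relation send \<open>(x, y, z)\<close> to a triple whose first entry is
  \<open>\<lambda>\<close> of \<open>x \<circ> y\<close> at \<open>z\<close>, whose last entry is \<open>\<tau>\<close> of \<open>y \<circ> z\<close> at \<open>x\<close>, and whose circle product is
  \<open>x \<circ> y \<circ> z\<close>; the middle entries then agree by cancellation.
\<close>

section \<open>Arithmetic of a skew left brace\<close>

context skew_left_brace
begin

abbreviation circ_mult (infixl "\<circ>\<^sub>B" 70) where
  "a \<circ>\<^sub>B b \<equiv> a \<otimes>\<^bsub>B\<^esub> b"

abbreviation lam :: "'a \<Rightarrow> 'a \<Rightarrow> 'a" where
  "lam \<equiv> brace_lambda A B"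

lemma circ_closed [simp]:
  "a \<in> carrier A \<Longrightarrow> b \<in> carrier A \<Longrightarrow> a \<circ>\<^sub>B b \<in> carrier A"
  using circ.m_closed carrier_eq by simp

lemma circ_inv_closed [simp]: "a \<in> carrier A \<Longrightarrow> inv\<^bsub>B\<^esub> a \<in> carrier A"
  using circ.inv_closed carrier_eq by simp

lemma circ_one_closed: "\<one>\<^bsub>B\<^esub> \<in> carrier A"
  using circ.one_closed carrier_eq by simp

lemma circ_assoc:
  "a \<in> carrier A \<Longrightarrow> b \<in> carrier A \<Longrightarrow> c \<in> carrier A \<Longrightarrow> a \<circ>\<^sub>B b \<circ>\<^sub>B c = a \<circ>\<^sub>B (b \<circ>\<^sub>B c)"
  using circ.m_assoc carrier_eq by simp

lemma circ_left_cancel: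
  "a \<in> carrier A \<Longrightarrow> b \<in> carrier A \<Longrightarrow> c \<in> carrier A \<Longrightarrow> a \<circ>\<^sub>B b = a \<circ>\<^sub>B c \<longleftrightarrow> b = c"
  using circ.Units_l_cancel circ.Units_eq carrier_eq by simp

lemma circ_right_cancel:
  "a \<in> carrier A \<Longrightarrow> b \<in> carrier A \<Longrightarrow> c \<in> carrier A \<Longrightarrow> b \<circ>\<^sub>B a = c \<circ>\<^sub>B a \<longleftrightarrow> b = c"
  using circ.right_cancel carrier_eq by simp

lemma circ_inv_left_cancel:
  "a \<in> carrier A \<Longrightarrow> b \<in> carrier A \<Longrightarrow> a \<circ>\<^sub>B (inv\<^bsub>B\<^esub> a \<circ>\<^sub>B b) = b"
  using carrier_eq by (simp add: circ.m_assoc [symmetric])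

lemma dot_inv_left_cancel:
  "a \<in> carrier A \<Longrightarrow> b \<in> carrier A \<Longrightarrow> a \<otimes>\<^bsub>A\<^esub> (inv\<^bsub>A\<^esub> a \<otimes>\<^bsub>A\<^esub> b) = b"
  by (simp add: dot.m_assoc [symmetric])

text \<open>
  Expanding \<open>\<one>\<^sub>A = \<one>\<^sub>B \<circ> (\<one>\<^sub>A \<one>\<^sub>A)\<close> by compatibility equates \<open>\<one>\<^sub>A\<close> with the dot inverse of \<open>\<one>\<^sub>B\<close>.
\<close>

lemma one_eq: "\<one>\<^bsub>B\<^esub> = \<one>\<^bsub>A\<^esub>"
proof -
  have "\<one>\<^bsub>B\<^esub> \<circ>\<^sub>B \<one>\<^bsub>A\<^esub> = \<one>\<^bsub>A\<^esub>"
    using circ.l_one carrier_eq by simp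
  then have "\<one>\<^bsub>A\<^esub> = inv\<^bsub>A\<^esub> \<one>\<^bsub>B\<^esub>"
    using brace_compat [of "\<one>\<^bsub>B\<^esub>" "\<one>\<^bsub>A\<^esub>" "\<one>\<^bsub>A\<^esub>"] circ_one_closed by simp
  then show ?thesis
    using circ_one_closed dot.inv_inv dot.inv_one by metis
qed

lemma circ_one_left [simp]: "a \<in> carrier A \<Longrightarrow> \<one>\<^bsub>A\<^esub> \<circ>\<^sub>B a = a"
  using circ.l_one carrier_eq one_eq by simp

lemma circ_one_right [simp]: "a \<in> carrier A \<Longrightarrow> a \<circ>\<^sub>B \<one>\<^bsub>A\<^esub> = a"
  using circ.r_one carrier_eq one_eq by simp

lemma circ_inv_right [simp]: "a \<in> carrier A \<Longrightarrow> a \<circ>\<^sub>B inv\<^bsub>B\<^esub> a = \<one>\<^bsub>A\<^esub>"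
  using circ.r_inv carrier_eq one_eq by simp

lemma circ_inv_left [simp]: "a \<in> carrier A \<Longrightarrow> inv\<^bsub>B\<^esub> a \<circ>\<^sub>B a = \<one>\<^bsub>A\<^esub>"
  using circ.l_inv carrier_eq one_eq by simp

section \<open>The left action\<close>

lemma lambda_closed [simp]:
  "a \<in> carrier A \<Longrightarrow> b \<in> carrier A \<Longrightarrow> lam a b \<in> carrier A"
  by (simp add: brace_lambda_def)

lemma dot_lambda: "a \<in> carrier A \<Longrightarrow> b \<in> carrier A \<Longrightarrow> a \<otimes>\<^bsub>A\<^esub> lam a b = a \<circ>\<^sub>B b"
  by (simp add: brace_lambda_def dot_inv_left_cancel)

lemma lambda_dot:
  assumes "a \<in> carrier A" "b \<in> carrier A" "c \<in> carrier A"
  shows "lam a (b \<otimes>\<^bsub>A\<^esub> c) = lam a b \<otimes>\<^bsub>A\<^esub> lam a c"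
  using assms by (simp add: brace_lambda_def brace_compat dot.m_assoc)

text \<open>
  Expanding \<open>a \<circ> (b \<lambda>\<^sub>b c) = a \<circ> (b \<circ> c)\<close> by compatibility gives
  \<open>(a \<circ> b) \<lambda>\<^sub>a (\<lambda>\<^sub>b c) = (a \<circ> b) \<lambda>\<^bsub>a \<circ> b\<^esub> c\<close>.
\<close>

lemma lambda_circ:
  assumes "a \<in> carrier A" "b \<in> carrier A" "c \<in> carrier A"
  shows "lam (a \<circ>\<^sub>B b) c = lam a (lam b c)"
proof -
  have "(a \<circ>\<^sub>B b) \<otimes>\<^bsub>A\<^esub> lam (a \<circ>\<^sub>B b) c = a \<circ>\<^sub>B (b \<otimes>\<^bsub>A\<^esub> lam b c)"
    using assms by (simp add: dot_lambda circ_assoc)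
  also have "\<dots> = (a \<circ>\<^sub>B b) \<otimes>\<^bsub>A\<^esub> lam a (lam b c)"
    using assms by (simp add: brace_compat brace_lambda_def [of A B a] dot.m_assoc)
  finally show ?thesis
    using assms by simp
qed

lemma lambda_one_left: "b \<in> carrier A \<Longrightarrow> lam \<one>\<^bsub>A\<^esub> b = b"
  by (simp add: brace_lambda_def)

lemma lambda_one_right: "a \<in> carrier A \<Longrightarrow> lam a \<one>\<^bsub>A\<^esub> = \<one>\<^bsub>A\<^esub>"
  by (simp add: brace_lambda_def)

lemma bij_lambda:
  assumes a: "a \<in> carrier A"
  shows "bij_betw (lam a) (carrier A) (carrier A)"
  by (rule bij_betw_byWitness [where f' = "lam (inv\<^bsub>B\<^esub> a)"])
     (use a in \<open>auto simp: lambda_circ [symmetric] lambda_one_left\<close>)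

section \<open>The right action and non-degeneracy\<close>

text \<open>The second component of \<open>brace_r\<close>, in the form that makes \<open>r\<close> preserve the circle product.\<close>

definition rho :: "'a \<Rightarrow> 'a \<Rightarrow> 'a" where
  "rho b a = inv\<^bsub>B\<^esub> (lam a b) \<circ>\<^sub>B (a \<circ>\<^sub>B b)"

lemma rho_closed [simp]:
  "a \<in> carrier A \<Longrightarrow> b \<in> carrier A \<Longrightarrow> rho b a \<in> carrier A"
  by (simp add: rho_def)

lemma lambda_circ_rho:
  "a \<in> carrier A \<Longrightarrow> b \<in> carrier A \<Longrightarrow> lam a b \<circ>\<^sub>B rho b a = a \<circ>\<^sub>B b"
  by (simp add: rho_def circ_inv_left_cancel)

text \<open>
  Since \<open>\<sigma> \<lambda>\<^sub>\<sigma> \<tau> = \<sigma> \<circ> \<tau>\<close>, the condition \<open>\<sigma> \<circ> \<tau> = a \<circ> b\<close> amounts to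
  \<open>\<lambda>\<^sub>\<sigma> \<tau> = \<sigma>\<inverse> (a \<circ> b)\<close>, and \<open>\<sigma>\<inverse> = (a \<circ> b)\<inverse> a\<close>.
\<close>

lemma brace_r_eq:
  assumes a: "a \<in> carrier A" and b: "b \<in> carrier A"
  shows "brace_r A B (a, b) = (lam a b, rho b a)"
proof -
  let ?s = "lam a b"
  have "?s \<otimes>\<^bsub>A\<^esub> lam ?s (rho b a) = a \<circ>\<^sub>B b"
    using a b by (simp add: dot_lambda lambda_circ_rho)
  also have "\<dots> = ?s \<otimes>\<^bsub>A\<^esub> (inv\<^bsub>A\<^esub> (a \<circ>\<^sub>B b) \<otimes>\<^bsub>A\<^esub> a \<otimes>\<^bsub>A\<^esub> (a \<circ>\<^sub>B b))"
    using a b by (simp add: brace_lambda_def dot.m_assoc dot_inv_left_cancel)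
       (simp add: dot.m_assoc [symmetric])
  finally have "lam ?s (rho b a) = inv\<^bsub>A\<^esub> (a \<circ>\<^sub>B b) \<otimes>\<^bsub>A\<^esub> a \<otimes>\<^bsub>A\<^esub> (a \<circ>\<^sub>B b)"
    using a b by simp
  moreover have "inj_on (lam ?s) (carrier A)"
    using bij_lambda a b by (simp add: bij_betw_def)
  ultimately have "inv_into (carrier A) (lam ?s)
      (inv\<^bsub>A\<^esub> (a \<circ>\<^sub>B b) \<otimes>\<^bsub>A\<^esub> a \<otimes>\<^bsub>A\<^esub> (a \<circ>\<^sub>B b)) = rho b a"
    using a b by (intro inv_into_f_eq) auto
  then show ?thesis
    by (simp add: brace_r_def)
qed

text \<open>
  Both sides equal \<open>\<lambda>\<^sub>a b\<close> times \<open>\<lambda>\<^bsub>a \<circ> b\<^esub> c\<close>: on the left because \<open>b \<circ> c = b \<lambda>\<^sub>b c\<close> and \<open>\<lambda>\<^sub>a\<close> is a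
  dot homomorphism, on the right because \<open>\<lambda>\<^sub>a b\<close> and \<open>rho b a\<close> have circle product \<open>a \<circ> b\<close>.
\<close>

lemma lambda_of_circ:
  assumes "a \<in> carrier A" "b \<in> carrier A" "c \<in> carrier A"
  shows "lam a (b \<circ>\<^sub>B c) = lam a b \<circ>\<^sub>B lam (rho b a) c"
proof -
  have "lam a (b \<circ>\<^sub>B c) = lam a b \<otimes>\<^bsub>A\<^esub> lam (a \<circ>\<^sub>B b) c"
    using assms by (simp add: dot_lambda [of b c, symmetric] lambda_dot lambda_circ)
  also have "\<dots> = lam a b \<otimes>\<^bsub>A\<^esub> lam (lam a b) (lam (rho b a) c)"
    using assms by (simp add: lambda_circ [symmetric] lambda_circ_rho)
  finally show ?thesis
    using assms by (simp add: dot_lambda)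
qed

text \<open>
  By \<open>lambda_of_circ\<close> both sides complete \<open>\<lambda>\<^sub>a (b \<circ> c)\<close> to the circle product
  \<open>a \<circ> b \<circ> c\<close>.
\<close>

lemma rho_circ:
  assumes "a \<in> carrier A" "b \<in> carrier A" "c \<in> carrier A"
  shows "rho (b \<circ>\<^sub>B c) a = rho c (rho b a)"
proof -
  have "lam a (b \<circ>\<^sub>B c) \<circ>\<^sub>B rho c (rho b a)
      = lam a b \<circ>\<^sub>B (lam (rho b a) c \<circ>\<^sub>B rho c (rho b a))"
    using assms by (simp add: lambda_of_circ circ_assoc)
  also have "\<dots> = (lam a b \<circ>\<^sub>B rho b a) \<circ>\<^sub>B c"
    using assms by (simp add: lambda_circ_rho circ_assoc [symmetric])
  also have "\<dots> = lam a (b \<circ>\<^sub>B c) \<circ>\<^sub>B rho (b \<circ>\<^sub>B c) a"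
    using assms by (simp add: lambda_circ_rho circ_assoc)
  finally show ?thesis
    using assms by (simp add: circ_left_cancel)
qed

lemma rho_one: "a \<in> carrier A \<Longrightarrow> rho \<one>\<^bsub>A\<^esub> a = a"
  using lambda_circ_rho [of a "\<one>\<^bsub>A\<^esub>"] by (simp add: lambda_one_right)

lemma bij_rho:
  assumes b: "b \<in> carrier A"
  shows "bij_betw (rho b) (carrier A) (carrier A)"
  by (rule bij_betw_byWitness [where f' = "rho (inv\<^bsub>B\<^esub> b)"])
     (use b in \<open>auto simp: rho_circ [symmetric] rho_one\<close>)

lemma brace_r_nondegenerate: "ybe_nondegenerate (carrier A) (brace_r A B)"
  unfolding ybe_nondegenerate_def
proof (intro ballI conjI)
  fix x assume x: "x \<in> carrier A"
  show "bij_betw (ybe_sigma (brace_r A B) x) (carrier A) (carrier A)"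
    using bij_lambda [OF x] by (rule bij_betw_cong [THEN iffD1, rotated])
      (simp add: ybe_sigma_def brace_r_eq x)
  show "bij_betw (ybe_tau (brace_r A B) x) (carrier A) (carrier A)"
    using bij_rho [OF x] by (rule bij_betw_cong [THEN iffD1, rotated])
      (simp add: ybe_tau_def brace_r_eq x)
qed

section \<open>Bijectivity and the braid relation\<close>

text \<open>
  With \<open>c = a \<circ> b\<close> the map is \<open>(a, c) \<mapsto> (a\<inverse> c, c)\<close>: the pair \<open>(u, v)\<close> has
  \<open>c = u \<circ> v\<close> and therefore comes from \<open>a = c u\<inverse>\<close>.
\<close>

lemma brace_r_bij:
  "bij_betw (brace_r A B) (carrier A \<times> carrier A) (carrier A \<times> carrier A)"
proof (rule bij_betw_byWitness
    [where f' = "\<lambda>(u, v). (u \<circ>\<^sub>B v \<otimes>\<^bsub>A\<^esub> inv\<^bsub>A\<^esub> u,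
                 inv\<^bsub>B\<^esub> (u \<circ>\<^sub>B v \<otimes>\<^bsub>A\<^esub> inv\<^bsub>A\<^esub> u) \<circ>\<^sub>B (u \<circ>\<^sub>B v))"])
  have "a \<circ>\<^sub>B b \<otimes>\<^bsub>A\<^esub> inv\<^bsub>A\<^esub> (lam a b) = a" if "a \<in> carrier A" "b \<in> carrier A" for a b
    using that by (simp add: dot_lambda [symmetric] dot.m_assoc)
  then show "\<forall>p \<in> carrier A \<times> carrier A. (\<lambda>(u, v). (u \<circ>\<^sub>B v \<otimes>\<^bsub>A\<^esub> inv\<^bsub>A\<^esub> u,
      inv\<^bsub>B\<^esub> (u \<circ>\<^sub>B v \<otimes>\<^bsub>A\<^esub> inv\<^bsub>A\<^esub> u) \<circ>\<^sub>B (u \<circ>\<^sub>B v))) (brace_r A B p) = p"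
    by (auto simp: brace_r_eq lambda_circ_rho circ_assoc [symmetric])
next
  have "brace_r A B (u \<circ>\<^sub>B v \<otimes>\<^bsub>A\<^esub> inv\<^bsub>A\<^esub> u,
      inv\<^bsub>B\<^esub> (u \<circ>\<^sub>B v \<otimes>\<^bsub>A\<^esub> inv\<^bsub>A\<^esub> u) \<circ>\<^sub>B (u \<circ>\<^sub>B v)) = (u, v)"
    if u: "u \<in> carrier A" and v: "v \<in> carrier A" for u v
  proof -
    define a where "a = u \<circ>\<^sub>B v \<otimes>\<^bsub>A\<^esub> inv\<^bsub>A\<^esub> u"
    define b where "b = inv\<^bsub>B\<^esub> a \<circ>\<^sub>B (u \<circ>\<^sub>B v)"
    have a: "a \<in> carrier A" and b: "b \<in> carrier A"
      using u v by (simp_all add: a_def b_def)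
    have ab: "a \<circ>\<^sub>B b = u \<circ>\<^sub>B v"
      using a u v by (simp add: b_def circ_inv_left_cancel)
    have "a \<otimes>\<^bsub>A\<^esub> lam a b = a \<otimes>\<^bsub>A\<^esub> u"
      using a b u v ab by (simp add: dot_lambda) (simp add: a_def dot.m_assoc)
    then have s: "lam a b = u"
      using a b u by simp
    then have "rho b a = v"
      using lambda_circ_rho [OF a b] a b u v ab circ_left_cancel rho_closed by simp
    with s have "brace_r A B (a, b) = (u, v)"
      using a b by (simp add: brace_r_eq)
    then show ?thesis
      by (simp only: a_def b_def)
  qed
  then show "\<forall>p \<in> carrier A \<times> carrier A. brace_r A B ((\<lambda>(u, v). (u \<circ>\<^sub>B v \<otimes>\<^bsub>A\<^esub> inv\<^bsub>A\<^esub> u,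
      inv\<^bsub>B\<^esub> (u \<circ>\<^sub>B v \<otimes>\<^bsub>A\<^esub> inv\<^bsub>A\<^esub> u) \<circ>\<^sub>B (u \<circ>\<^sub>B v))) p) = p"
    by auto
qed (auto simp: brace_r_eq)

text \<open>
  The actions settle the outer entries of the two triples; the invariance of the circle product
  settles the middle one.
\<close>

lemma brace_r_braid:
  assumes x: "x \<in> carrier A" and y: "y \<in> carrier A" and z: "z \<in> carrier A"
  shows "(r_times_id (brace_r A B) \<circ> id_times_r (brace_r A B) \<circ> r_times_id (brace_r A B)) (x, y, z)
       = (id_times_r (brace_r A B) \<circ> r_times_id (brace_r A B) \<circ> id_times_r (brace_r A B)) (x, y, z)"
proof -
  \<comment> \<open>the middle entry that each side passes on to its last application of \<open>r\<close>\<close>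
  define p where "p = lam (rho y x) z"
  define q where "q = rho (lam y z) x"
  \<comment> \<open>\<open>(a, b, c)\<close> and \<open>(a', b', c')\<close> are the left and the right triple\<close>
  define a where "a = lam (lam x y) p"
  define b where "b = rho p (lam x y)"
  define c where "c = rho z (rho y x)"
  define a' where "a' = lam x (lam y z)"
  define b' where "b' = lam q (rho z y)"
  define c' where "c' = rho (rho z y) q"
  have [simp]: "p \<in> carrier A" "q \<in> carrier A" "a \<in> carrier A" "b \<in> carrier A"
      "c \<in> carrier A" "b' \<in> carrier A"
    using x y z by (simp_all add: p_def q_def a_def b_def c_def b'_def)
  have a: "a = a'"
    using x y z by (simp add: a_def a'_def p_def lambda_circ [symmetric] lambda_circ_rho)
  have c: "c = c'"
    using x y z by (simp add: c_def c'_def q_def rho_circ [symmetric] lambda_circ_rho)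
  have "a \<circ>\<^sub>B b \<circ>\<^sub>B c = lam x y \<circ>\<^sub>B (p \<circ>\<^sub>B c)"
    using x y by (simp add: a_def b_def lambda_circ_rho circ_assoc)
  also have "\<dots> = x \<circ>\<^sub>B (y \<circ>\<^sub>B z)"
    using x y z by (simp add: p_def c_def lambda_circ_rho circ_assoc [symmetric])
  also have "\<dots> = a' \<circ>\<^sub>B q \<circ>\<^sub>B rho z y"
    using x y z by (simp add: a'_def q_def lambda_circ_rho circ_assoc)
  also have "\<dots> = a' \<circ>\<^sub>B (b' \<circ>\<^sub>B c')"
    using x y z by (simp add: a'_def b'_def c'_def lambda_circ_rho circ_assoc)
  finally have "a \<circ>\<^sub>B b \<circ>\<^sub>B c = a \<circ>\<^sub>B b' \<circ>\<^sub>B c"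
    by (simp add: a [symmetric] c [symmetric] circ_assoc)
  then have "b = b'"
    by (simp add: circ_right_cancel circ_left_cancel)
  with a c show ?thesis
    using x y z
    by (simp add: r_times_id_def id_times_r_def brace_r_eq
        a_def b_def c_def a'_def b'_def c'_def p_def q_def)
qed

section \<open>Involutivity\<close>

text \<open>
  Applying \<open>(a, c) \<mapsto> (a\<inverse> c, c)\<close> twice gives \<open>(c\<inverse> a c, c)\<close>, where \<open>c = a \<circ> b\<close>.
\<close>

lemma lambda_twice:
  assumes "a \<in> carrier A" "b \<in> carrier A"
  shows "lam (lam a b) (rho b a) = inv\<^bsub>A\<^esub> (a \<circ>\<^sub>B b) \<otimes>\<^bsub>A\<^esub> a \<otimes>\<^bsub>A\<^esub> (a \<circ>\<^sub>B b)"
  using assms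
  by (simp add: brace_lambda_def [of A B "lam a b"] lambda_circ_rho)
     (simp add: brace_lambda_def dot.inv_mult_group)

lemma brace_r_twice_eq_iff:
  assumes a: "a \<in> carrier A" and b: "b \<in> carrier A"
  shows "brace_r A B (brace_r A B (a, b)) = (a, b) \<longleftrightarrow>
    a \<otimes>\<^bsub>A\<^esub> (a \<circ>\<^sub>B b) = (a \<circ>\<^sub>B b) \<otimes>\<^bsub>A\<^esub> a"
proof -
  define d where "d = lam (lam a b) (rho b a)"
  define e where "e = rho (rho b a) (lam a b)"
  have d: "d \<in> carrier A" and e: "e \<in> carrier A"
    using a b by (simp_all add: d_def e_def)
  have "d \<circ>\<^sub>B e = a \<circ>\<^sub>B b"
    using a b by (simp add: d_def e_def lambda_circ_rho)
  then have "d = a \<Longrightarrow> e = b"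
    using a b e circ_left_cancel by simp
  then have "brace_r A B (brace_r A B (a, b)) = (a, b) \<longleftrightarrow> d = a"
    using a b by (auto simp: brace_r_eq d_def e_def)
  also have "\<dots> \<longleftrightarrow> (a \<circ>\<^sub>B b) \<otimes>\<^bsub>A\<^esub> d = (a \<circ>\<^sub>B b) \<otimes>\<^bsub>A\<^esub> a"
    using a b d by simp
  also have "(a \<circ>\<^sub>B b) \<otimes>\<^bsub>A\<^esub> d = a \<otimes>\<^bsub>A\<^esub> (a \<circ>\<^sub>B b)"
    using a b by (simp add: d_def lambda_twice dot.m_assoc dot_inv_left_cancel)
  finally show ?thesis .
qed

text \<open>For fixed \<open>a\<close>, every element \<open>c\<close> of the carrier has the form \<open>a \<circ> b\<close>.\<close>

lemma brace_r_involutive_iff: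
  "ybe_involutive (carrier A) (brace_r A B) \<longleftrightarrow>
    (\<forall>a \<in> carrier A. \<forall>c \<in> carrier A. a \<otimes>\<^bsub>A\<^esub> c = c \<otimes>\<^bsub>A\<^esub> a)"
proof
  assume inv: "ybe_involutive (carrier A) (brace_r A B)"
  show "\<forall>a \<in> carrier A. \<forall>c \<in> carrier A. a \<otimes>\<^bsub>A\<^esub> c = c \<otimes>\<^bsub>A\<^esub> a"
  proof (intro ballI)
    fix a c assume a: "a \<in> carrier A" and c: "c \<in> carrier A"
    define b where "b = inv\<^bsub>B\<^esub> a \<circ>\<^sub>B c"
    have b: "b \<in> carrier A" and "a \<circ>\<^sub>B b = c"
      using a c by (simp_all add: b_def circ_inv_left_cancel)
    moreover have "brace_r A B (brace_r A B (a, b)) = (a, b)"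
      using inv a b by (auto simp: ybe_involutive_def)
    ultimately show "a \<otimes>\<^bsub>A\<^esub> c = c \<otimes>\<^bsub>A\<^esub> a"
      using brace_r_twice_eq_iff [OF a b] by simp
  qed
next
  assume "\<forall>a \<in> carrier A. \<forall>c \<in> carrier A. a \<otimes>\<^bsub>A\<^esub> c = c \<otimes>\<^bsub>A\<^esub> a"
  then show "ybe_involutive (carrier A) (brace_r A B)"
    by (auto simp: ybe_involutive_def brace_r_twice_eq_iff)
qed

end

theorem theorem3p1:
  fixes A :: "('a, 'm) monoid_scheme" and B :: "('a, 'n) monoid_scheme"
  assumes "skew_left_brace A B"
  shows "ybe_solution (carrier A) (brace_r A B) \<and>
    ybe_nondegenerate (carrier A) (brace_r A B) \<and>
    (ybe_involutive (carrier A) (brace_r A B) \<longleftrightarrow>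
      (\<forall>a \<in> carrier A. \<forall>b \<in> carrier A. a \<otimes>\<^bsub>A\<^esub> b = b \<otimes>\<^bsub>A\<^esub> a))"
proof -
  interpret skew_left_brace A B by (rule assms)
  have "ybe_solution (carrier A) (brace_r A B)"
    unfolding ybe_solution_def
    using brace_r_bij brace_r_braid by blast
  then show ?thesis
    using brace_r_nondegenerate brace_r_involutive_iff by blast
qed

end
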